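(* Let $G$ be a finite abstract simplicial complex with $n$ elements and Dirac matrix $D$. Let $\lambda_1\ge\lambda_2\ge\cdots\ge\lambda_n$ be the eigenvalues of $D$ (with multiplicity) and let $d_1\ge d_2\ge\cdots\ge d_n$ be the vertex degrees of the Dirac graph of $G$, both in descending order. Then $\lambda_j\le d_j$ for all $1\le j\le n$. The same holds for open sets: if $U\subset G$ is open, then the descending ordered eigenvalues of $D_U$ are bounded above, index by index, by the descending ordered vertex degrees of the Dirac graph of $U$.
   Context: A finite abstract simplicial complex $G$ is a finite set of non-empty finite sets (simplices) closed under taking non-empty subsets. A set $U\subset G$ is open if $x\in U$, $y\in G$, $x\subset y$ imply $y\in U$. Fix an ordering of the vertices of each simplex. For $y\subset x$ with $|x|=|y|+1$, $\mathrm{sign}(x,y)\in\{1,-1\}$ is the sign of the permutation that takes the list $(v,y)$ ($v$ the vertex in $x\setminus y$, followed by the ordered vertices of $y$) to the ordered list of vertices of $x$. The exterior derivative $d$ is the matrix indexed by $G\times G$ with $d(x,y)=\mathrm{sign}(x,y)$ if $y\subset x$ and $|x|=|y|+1$, and $d(x,y)=0$ otherwise. The Dirac matrix is $D=d+d^*$, with $d^*$ the transpose. For an open set $U\subset G$, $D_U$ is the matrix defined by the same formula with rows and columns indexed by $U$. The Dirac graph of $G$ (respectively $U$) has the elements of $G$ (respectively $U$) as vertices, and two vertices $x,y$ are connected if $D(x,y)\ne0$ (respectively $D_U(x,y)\neq 0$); the degree of $x$ is $d_x=\sum_y|D(x,y)|$ (respectively $\sum_{y\in U}|D_U(x,y)|$).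 *)

theory Defs
  imports "Jordan_Normal_Form.Char_Poly" "HOL-Combinatorics.Permutations"
begin

definition simplicial_complex :: "'a set set \<Rightarrow> bool" where
  "simplicial_complex G \<longleftrightarrow>
     finite G \<and> (\<forall>x\<in>G. finite x \<and> x \<noteq> {}) \<and>
     (\<forall>x\<in>G. \<forall>y. y \<noteq> {} \<and> y \<subseteq> x \<longrightarrow> y \<in> G)"

definition open_in :: "'a set set \<Rightarrow> 'a set set \<Rightarrow> bool" where
  "open_in G U \<longleftrightarrow> U \<subseteq> G \<and> (\<forall>x\<in>U. \<forall>y\<in>G. x \<subseteq> y \<longrightarrow> y \<in> U)"

text \<open>The vertices of each simplex are ordered separately: the orders of different
  simplices need not be compatible with each other.\<close>

definition vertex_ordering :: "'a set set \<Rightarrow> ('a set \<Rightarrow> 'a list) \<Rightarrow> bool" where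
  "vertex_ordering G vs \<longleftrightarrow> (\<forall>x\<in>G. distinct (vs x) \<and> set (vs x) = x)"

definition perm_taking :: "'a list \<Rightarrow> 'a list \<Rightarrow> 'a \<Rightarrow> 'a" where
  "perm_taking xs ys = (THE p. p permutes set ys \<and> map p xs = ys)"

lemma ex1_perm_taking:
  assumes "distinct xs" "distinct ys" "set xs = set ys"
  shows "\<exists>!p. p permutes set ys \<and> map p xs = ys"
proof -
  have len: "length xs = length ys"
    using assms by (metis distinct_card)
  define p where "p = (\<lambda>v. case map_of (zip xs ys) v of Some w \<Rightarrow> w | None \<Rightarrow> v)"
  have nth: "p (xs ! i) = ys ! i" if "i < length xs" for i
    using that len assms(1) by (simp add: p_def map_of_zip_nth)
  have map: "map p xs = ys"
    using len nth by (intro nth_equalityI) auto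
  have "p permutes set ys"
  proof (rule bij_imp_permutes)
    have "inj_on p (set xs)"
      using assms(2) map by (metis distinct_map)
    moreover have "p ` set xs = set ys"
      using map by (metis set_map)
    ultimately show "bij_betw p (set ys) (set ys)"
      using assms(3) by (simp add: bij_betw_def)
    show "p v = v" if "v \<notin> set ys" for v
      using that assms(3) len by (auto simp: p_def map_of_eq_None_iff split: option.split dest!: map_of_SomeD set_zip_leftD)
  qed
  moreover have "q = p" if "q permutes set ys" "map q xs = ys" for q
  proof
    fix v
    show "q v = p v"
    proof (cases "v \<in> set ys")
      case True
      then show ?thesis using assms(3) that(2) map by (metis map_eq_conv)
    next
      case False
      then show ?thesis
        using that(1) \<open>p permutes set ys\<close> by (simp add: permutes_not_in)
    qed
  qed
  ultimately show ?thesis using map by blast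
qed

definition face_sign :: "('a set \<Rightarrow> 'a list) \<Rightarrow> 'a set \<Rightarrow> 'a set \<Rightarrow> real" where
  "face_sign vs x y = real_of_int (sign (perm_taking (the_elem (x - y) # vs y) (vs x)))"

definition ext_deriv :: "('a set \<Rightarrow> 'a list) \<Rightarrow> 'a set \<Rightarrow> 'a set \<Rightarrow> real" where
  "ext_deriv vs x y = (if y \<subseteq> x \<and> card x = card y + 1 then face_sign vs x y else 0)"

definition dirac :: "('a set \<Rightarrow> 'a list) \<Rightarrow> 'a set \<Rightarrow> 'a set \<Rightarrow> real" where
  "dirac vs x y = ext_deriv vs x y + ext_deriv vs y x"

text \<open>The list \<open>xs\<close> enumerates, without repetition, the set of simplices that indexes
  the rows and columns.\<close>

definition dirac_matrix :: "('a set \<Rightarrow> 'a list) \<Rightarrow> 'a set list \<Rightarrow> real mat" where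
  "dirac_matrix vs xs = mat (length xs) (length xs) (\<lambda>(i, j). dirac vs (xs ! i) (xs ! j))"

definition dirac_degree :: "('a set \<Rightarrow> 'a list) \<Rightarrow> 'a set set \<Rightarrow> 'a set \<Rightarrow> real" where
  "dirac_degree vs U x = (\<Sum>y\<in>U. \<bar>dirac vs x y\<bar>)"

lemma dirac_degree_eq_card_neighbours:
  assumes "finite U"
  shows "dirac_degree vs U x = real (card {y \<in> U. dirac vs x y \<noteq> 0})"
proof -
  have "\<bar>dirac vs x y\<bar> = (if dirac vs x y \<noteq> 0 then 1 else 0)" for y
    by (simp add: dirac_def ext_deriv_def face_sign_def sign_def)
  then show ?thesis
    using assms by (simp add: dirac_degree_def sum.If_cases Int_def)
qed

text \<open>Real eigenvalues with algebraic multiplicity. The list has as many entries as the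
  matrix has rows exactly if the characteristic polynomial splits over the reals.\<close>

definition eigenvalues_desc :: "real mat \<Rightarrow> real list" where
  "eigenvalues_desc A = rev (sorted_list_of_multiset (proots (char_poly A)))"

definition degrees_desc :: "('a set \<Rightarrow> 'a list) \<Rightarrow> 'a set set \<Rightarrow> real list" where
  "degrees_desc vs U =
     rev (sorted_list_of_multiset (image_mset (dirac_degree vs U) (mset_set U)))"

end

theory Submission
  imports Defs "Jordan_Normal_Form.Schur_Decomposition" "Jordan_Normal_Form.Spectral_Radius"
begin

text \<open>The bound holds for every real symmetric matrix \<open>A\<close>: the \<open>j\<close>-th largest eigenvalue is at
  most the \<open>j\<close>-th largest absolute row sum. Let \<open>s\<close> and \<open>t\<close> be these two numbers. The
  eigenvectors for eigenvalues \<open>\<ge> s\<close> span a space of dimension at least \<open>j\<close>, and fewer than \<open>j\<close>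
  rows have absolute row sum \<open>> t\<close>, so that space contains a vector \<open>x \<noteq> 0\<close> that vanishes at all
  these rows. The form \<open>x \<bullet> A x\<close> is then at least \<open>s (x \<bullet> x)\<close>, and
  \<open>2 x\<^sub>i x\<^sub>k \<le> x\<^sub>i\<^sup>2 + x\<^sub>k\<^sup>2\<close> shows that it is at most \<open>t (x \<bullet> x)\<close>.\<close>

section \<open>Orthogonal diagonalization and spectrum of real symmetric matrices\<close>

lemma symmetric_mat_swap:
  assumes "A \<in> carrier_mat n n" "A\<^sup>T = A" "i < n" "j < n"
  shows "A $$ (i, j) = A $$ (j, i)"
  using assms by (metis carrier_matD index_transpose_mat(1))

text \<open>Over the complex numbers an eigenvector \<open>z\<close> with eigenvalue
  \<open>\<mu>\<close> exists. Pairing \<open>A z = \<mu> z\<close> with the conjugate of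
  \<open>z\<close> gives \<open>S = \<mu> * N\<close>, where \<open>S\<close> and \<open>N\<close>
  are both real and \<open>N\<close> is nonzero, so \<open>\<mu>\<close> is real.\<close>

lemma real_symmetric_mat_eigenvalue:
  fixes A :: "real mat"
  assumes A: "A \<in> carrier_mat n n" and sym: "A\<^sup>T = A" and "n > 0"
  shows "\<exists>e. eigenvalue A e"
proof -
  let ?C = "map_mat complex_of_real A"
  have C: "?C \<in> carrier_mat n n" using A by simp
  obtain \<mu> z where ev: "eigenvector ?C z \<mu>"
    using spectrum_non_empty[OF C \<open>n > 0\<close>] by (auto simp: spectrum_def eigenvalue_def)
  have z: "z \<in> carrier_vec n" "z \<noteq> 0\<^sub>v n" and Cz: "?C *\<^sub>v z = \<mu> \<cdot>\<^sub>v z"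
    using ev C by (auto simp: eigenvector_def)
  have row: "(\<Sum>j<n. complex_of_real (A $$ (i, j)) * z $ j) = \<mu> * z $ i" if "i < n" for i
    using arg_cong[OF Cz, of "\<lambda>v. v $ i"] that A z(1)
    by (simp add: scalar_prod_def atLeast0LessThan)
  define N where "N = (\<Sum>i<n. cnj (z $ i) * z $ i)"
  define S where "S = (\<Sum>i<n. \<Sum>j<n. cnj (z $ i) * (complex_of_real (A $$ (i, j)) * z $ j))"
  have "S = \<mu> * N"
    by (simp add: S_def N_def row sum_distrib_left[symmetric] mult.left_commute)
  moreover have "cnj S = S"
  proof -
    have "cnj S = (\<Sum>i<n. \<Sum>j<n. z $ i * (complex_of_real (A $$ (i, j)) * cnj (z $ j)))"
      by (simp add: S_def)
    also have "\<dots> = (\<Sum>j<n. \<Sum>i<n. z $ i * (complex_of_real (A $$ (i, j)) * cnj (z $ j)))"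
      by (rule sum.swap)
    also have "\<dots> = S"
      unfolding S_def using symmetric_mat_swap[OF A sym]
      by (intro sum.cong refl) (simp add: mult.left_commute mult.commute)
    finally show ?thesis .
  qed
  moreover have "cnj N = N" by (simp add: N_def mult.commute)
  moreover have "N \<noteq> 0"
  proof -
    obtain i where i: "i < n" "z $ i \<noteq> 0"
      using z by (metis carrier_vecD eq_vecI index_zero_vec)
    have N: "N = complex_of_real (\<Sum>i<n. (cmod (z $ i))\<^sup>2)"
      by (simp add: N_def complex_norm_square[symmetric] mult.commute)
    have "(\<Sum>i<n. (cmod (z $ i))\<^sup>2) > 0"
      using i by (intro sum_pos2[of _ i]) auto
    then show ?thesis unfolding N by (simp del: of_real_sum)
  qed
  ultimately have "cnj \<mu> = \<mu>"
    by (metis complex_cnj_mult mult_right_cancel)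
  then obtain e where e: "\<mu> = complex_of_real e"
    by (metis Reals_cnj_iff Reals_cases)
  \<comment> \<open>The characteristic polynomial of \<open>?C\<close> is that of \<open>A\<close>
    with coefficients embedded in the complex numbers, so the real number \<open>e\<close> is
    already a root over the reals.\<close>
  have "poly (char_poly ?C) \<mu> = 0"
    using ev C eigenvalue_root_char_poly unfolding eigenvalue_def by blast
  then have "poly (map_poly complex_of_real (char_poly A)) (complex_of_real e) = 0"
    by (simp add: of_real_hom.char_poly_hom[OF A] e)
  then have "poly (char_poly A) e = 0" by simp
  then show ?thesis using eigenvalue_root_char_poly[OF A] by blast
qed

text \<open>Gram-Schmidt, applied to a basis that begins with \<open>v\<close>, leaves the first
  vector unchanged. Normalizing the resulting vectors gives the columns of \<open>W\<close>.\<close>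

lemma orthogonal_completion:
  fixes v :: "real vec"
  assumes v: "v \<in> carrier_vec n" "v \<noteq> 0\<^sub>v n" and "n > 0"
  shows "\<exists>W c. W \<in> carrier_mat n n \<and> W\<^sup>T * W = 1\<^sub>m n \<and> col W 0 = c \<cdot>\<^sub>v v"
proof -
  interpret cof_vec_space n "TYPE(real)" .
  define b where "b = basis_completion v"
  define ws where "ws = gram_schmidt n b"
  from basis_completion[OF v, folded b_def]
  have b: "set b \<subseteq> carrier_vec n" "distinct b" "\<not> lin_dep (set b)" "hd b = v" "length b = n"
    by auto
  obtain vs where bv: "b = v # vs" using b(4,5) \<open>n > 0\<close> by (cases b) auto
  from gram_schmidt_result[OF b(1-3) refl, folded ws_def]
  have ws: "set ws \<subseteq> carrier_vec n" "corthogonal ws" "length ws = n"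
    by (auto simp: b(5))
  have "hd ws = v" using gram_schmidt_hd[OF v(1), of vs] by (simp add: ws_def bv)
  then have ws0: "ws ! 0 = v" using ws(3) \<open>n > 0\<close> by (cases ws) auto
  have conj: "conjugate u = u" for u :: "real vec" by (intro eq_vecI) auto
  have dim: "ws ! i \<in> carrier_vec n" if "i < n" for i
    using ws that by (meson nth_mem subsetD)
  \<comment> \<open>The case \<open>i = j\<close> of the equivalence says that no vector has length
    zero, so the normalizing factors \<open>c i\<close> below are meaningful.\<close>
  have orth: "ws ! i \<bullet> ws ! j = 0 \<longleftrightarrow> i \<noteq> j" if "i < n" "j < n" for i j
    using corthogonalD[OF ws(2), of i j] that ws(3) by (simp add: conj)
  define c where "c i = 1 / sqrt (ws ! i \<bullet> ws ! i)" for i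
  define W where "W = mat_of_cols n (map (\<lambda>i. c i \<cdot>\<^sub>v ws ! i) [0..<n])"
  have W: "W \<in> carrier_mat n n" by (simp add: W_def mat_of_cols_def)
  have colW: "col W i = c i \<cdot>\<^sub>v ws ! i" if "i < n" for i
    using that dim by (simp add: W_def col_mat_of_cols)
  have nonneg: "ws ! i \<bullet> ws ! i \<ge> 0" for i by (auto simp: scalar_prod_def intro: sum_nonneg)
  have "W\<^sup>T * W = 1\<^sub>m n"
  proof (rule eq_matI)
    fix i j assume "i < dim_row (1\<^sub>m n :: real mat)" "j < dim_col (1\<^sub>m n :: real mat)"
    then have ij: "i < n" "j < n" by auto
    have "(W\<^sup>T * W) $$ (i, j) = c i * c j * (ws ! i \<bullet> ws ! j)"
      using ij W dim[of i] dim[of j] by (simp add: colW)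
    also have "\<dots> = 1\<^sub>m n $$ (i, j)"
    proof (cases "i = j")
      case True
      then show ?thesis using ij orth[of i i] nonneg[of i] by (simp add: c_def)
    next
      case False
      then show ?thesis using ij orth[of i j] by simp
    qed
    finally show "(W\<^sup>T * W) $$ (i, j) = 1\<^sub>m n $$ (i, j)" .
  qed (use W in auto)
  then show ?thesis using W colW[OF \<open>n > 0\<close>] ws0 by metis
qed

lemma orthogonal_mat_right_inverse:
  fixes P :: "'a::field mat"
  assumes "P \<in> carrier_mat n n" "P\<^sup>T * P = 1\<^sub>m n"
  shows "P * P\<^sup>T = 1\<^sub>m n"
  using assms by (intro mat_mult_left_right_inverse[of "P\<^sup>T" n P]) auto

text \<open>Induction on the size: an orthogonal change of basis \<open>W\<close> makes an
  eigenvector the first basis vector, symmetry then splits off a 1 by 1 block, and the induction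
  hypothesis diagonalizes the rest.\<close>

lemma real_symmetric_mat_diagonalization:
  fixes A :: "real mat"
  assumes "A \<in> carrier_mat n n" "A\<^sup>T = A"
  shows "\<exists>P f. P \<in> carrier_mat n n \<and> P\<^sup>T * P = 1\<^sub>m n \<and> P\<^sup>T * A * P = mat_diag n f"
  using assms
proof (induction n arbitrary: A)
  case 0
  then show ?case by (intro exI[of _ "1\<^sub>m 0"] exI[of _ "\<lambda>_. 0"]) (auto simp: mat_diag_def)
next
  case (Suc m)
  let ?n = "Suc m"
  note A = Suc.prems(1) and sym = Suc.prems(2)
  obtain e v where "eigenvector A v e"
    using real_symmetric_mat_eigenvalue[OF A sym] by (auto simp: eigenvalue_def)
  then have v: "v \<in> carrier_vec ?n" "v \<noteq> 0\<^sub>v ?n" and Av: "A *\<^sub>v v = e \<cdot>\<^sub>v v"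
    using A by (auto simp: eigenvector_def)
  obtain W c where W: "W \<in> carrier_mat ?n ?n" and WW: "W\<^sup>T * W = 1\<^sub>m ?n"
    and colW: "col W 0 = c \<cdot>\<^sub>v v"
    using orthogonal_completion[OF v] by auto
  define A' where "A' = W\<^sup>T * A * W"
  have A': "A' \<in> carrier_mat ?n ?n" using A W by (simp add: A'_def)
  have symA': "A'\<^sup>T = A'"
    using A W sym
    by (simp add: A'_def transpose_mult[of _ ?n ?n _ ?n] assoc_mult_mat[of _ ?n ?n _ ?n _ ?n])
  have "col A' 0 = e \<cdot>\<^sub>v unit_vec ?n 0"
  proof -
    have "col A' 0 = W\<^sup>T *\<^sub>v (A *\<^sub>v col W 0)"
    proof -
      have "col A' 0 = (W\<^sup>T * A) *\<^sub>v col W 0"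
        unfolding A'_def using A W by (intro col_mult2[of _ ?n ?n _ ?n]) auto
      also have "\<dots> = W\<^sup>T *\<^sub>v (A *\<^sub>v col W 0)"
        using A W by (intro assoc_mult_mat_vec[of _ ?n ?n _ ?n] col_carrier_vec[of _ ?n]) auto
      finally show ?thesis .
    qed
    also have "A *\<^sub>v col W 0 = e \<cdot>\<^sub>v col W 0"
      using A v(1) Av by (simp add: colW mult_mat_vec smult_smult_assoc mult.commute)
    also have "W\<^sup>T *\<^sub>v (e \<cdot>\<^sub>v col W 0) = e \<cdot>\<^sub>v col (W\<^sup>T * W) 0"
      using W mult_mat_vec[of "W\<^sup>T" ?n ?n "col W 0" e] col_carrier_vec[OF _ W, of 0]
      by (simp only: col_mult2[of "W\<^sup>T" ?n ?n W ?n 0] transpose_carrier_mat zero_less_Suc)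
    finally show ?thesis by (simp add: WW)
  qed
  then have col0: "A' $$ (i, 0) = (if i = 0 then e else 0)" if "i < ?n" for i
    using that A' by (metis (no_types, lifting) carrier_matD index_col index_smult_vec(1)
        index_unit_vec(1) mult.right_neutral mult_zero_right index_unit_vec(3) zero_less_Suc)
  define B where "B = mat m m (\<lambda>(i, j). A' $$ (Suc i, Suc j))"
  have B: "B \<in> carrier_mat m m" by (simp add: B_def)
  have symB: "B\<^sup>T = B"
    using symmetric_mat_swap[OF A' symA'] by (intro eq_matI) (auto simp: B_def)
  \<comment> \<open>The first column is zero below the diagonal by \<open>col0\<close>, hence by
    symmetry the first row is zero to the right of it.\<close>
  have block: "A' = four_block_mat (mat 1 1 (\<lambda>_. e)) (0\<^sub>m 1 m) (0\<^sub>m m 1) B"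
    using A' col0 symmetric_mat_swap[OF A' symA']
    by (intro eq_matI) (auto simp: B_def)
  obtain P f where P: "P \<in> carrier_mat m m" and PP: "P\<^sup>T * P = 1\<^sub>m m"
    and PBP: "P\<^sup>T * B * P = mat_diag m f"
    using Suc.IH[OF B symB] by auto
  \<comment> \<open>\<open>Q\<close> fixes the first coordinate and acts as \<open>P\<close> on the
    others; \<open>W * Q\<close> will be the diagonalizing matrix.\<close>
  define Q where "Q = four_block_mat (1\<^sub>m 1) (0\<^sub>m 1 m) (0\<^sub>m m 1) P"
  have Q: "Q \<in> carrier_mat ?n ?n" using P by (auto simp: Q_def intro!: carrier_matI)
  have QT: "Q\<^sup>T = four_block_mat (1\<^sub>m 1) (0\<^sub>m 1 m) (0\<^sub>m m 1) (P\<^sup>T)"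
    unfolding Q_def using P by (subst transpose_four_block_mat) auto
  have QQ: "Q\<^sup>T * Q = 1\<^sub>m ?n"
    unfolding QT unfolding Q_def using P PP
    by (subst mult_four_block_mat[of _ 1 1 _ m _ m _ _ 1 _ m]) (auto intro!: eq_matI)
  have "Q\<^sup>T * A' * Q = four_block_mat (mat 1 1 (\<lambda>_. e)) (0\<^sub>m 1 m) (0\<^sub>m m 1) (P\<^sup>T * B * P)"
    unfolding QT block unfolding Q_def using P B
    by (subst mult_four_block_mat[of _ 1 1 _ m _ m _ _ 1 _ m], auto)
       (subst mult_four_block_mat[of _ 1 1 _ m _ m _ _ 1 _ m], auto)
  \<comment> \<open>\<open>case_nat e f\<close> puts \<open>e\<close> at position 0 and shifts the
    entries of \<open>f\<close> by one.\<close>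
  also have "\<dots> = mat_diag ?n (case_nat e f)"
    unfolding PBP by (intro eq_matI) (auto simp: mat_diag_def split: nat.split)
  finally have diag: "Q\<^sup>T * A' * Q = mat_diag ?n (case_nat e f)" .
  have WQ: "(W * Q)\<^sup>T = Q\<^sup>T * W\<^sup>T" using W Q by (rule transpose_mult)
  have "(W * Q)\<^sup>T * (W * Q) = Q\<^sup>T * (W\<^sup>T * W) * Q"
    unfolding WQ using W Q by (simp add: assoc_mult_mat[of _ ?n ?n _ ?n _ ?n])
  moreover have "(W * Q)\<^sup>T * A * (W * Q) = Q\<^sup>T * A' * Q"
    unfolding WQ A'_def using W Q A by (simp add: assoc_mult_mat[of _ ?n ?n _ ?n _ ?n])
  ultimately have "W * Q \<in> carrier_mat ?n ?n \<and> (W * Q)\<^sup>T * (W * Q) = 1\<^sub>m ?n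
      \<and> (W * Q)\<^sup>T * A * (W * Q) = mat_diag ?n (case_nat e f)"
    using W Q QQ diag by (simp add: WW)
  then show ?case by blast
qed

text \<open>\<open>P\<^sup>T\<close> is the inverse of \<open>P\<close>, so \<open>A\<close> is
  similar to the diagonal matrix and its characteristic polynomial is a product of \<open>n\<close>
  linear factors. Thus \<open>f\<close> lists all eigenvalues with algebraic multiplicity.\<close>

lemma proots_char_poly_diagonalized:
  fixes A :: "'a::field mat"
  assumes A: "A \<in> carrier_mat n n" and P: "P \<in> carrier_mat n n" "P\<^sup>T * P = 1\<^sub>m n"
    and diag: "P\<^sup>T * A * P = mat_diag n f"
  shows "proots (char_poly A) = image_mset f (mset_set {..<n})"
proof -
  have "similar_mat_wit (mat_diag n f) A (P\<^sup>T) P"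
    using assms orthogonal_mat_right_inverse[OF P]
    by (intro similar_mat_witI[of _ _ n]) (auto simp: diag[symmetric])
  then have "char_poly A = char_poly (mat_diag n f)"
    by (metis char_poly_similar similar_mat_def)
  also have "\<dots> = (\<Prod>a\<leftarrow>diag_mat (mat_diag n f). [:- a, 1:])"
    by (intro char_poly_upper_triangular[of _ n]) (auto simp: mat_diag_def)
  also have "diag_mat (mat_diag n f) = map f [0..<n]"
    by (auto simp: diag_mat_def mat_diag_def)
  finally have "char_poly A = (\<Prod>i\<in>{..<n}. [:- f i, 1:])"
    by (simp add: prod.list_conv_set_nth comp_def atLeast0LessThan)
  then have "proots (char_poly A) = (\<Sum>i<n. {#f i#})"
    by (simp add: proots_prod)
  also have "\<dots> = image_mset f (mset_set {..<n})"
    by (induction n) (auto simp: lessThan_Suc)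
  finally show ?thesis .
qed

section \<open>Comparison of eigenvalues and row sums through the quadratic form\<close>

text \<open>Fewer homogeneous linear equations, one for each \<open>i\<close> in \<open>I\<close>,
  than free coordinates, one for each \<open>l\<close> in \<open>J\<close>. The solution is found as
  a kernel vector of a singular square matrix.\<close>

lemma exists_supported_vec_with_mult_vanishing_on:
  fixes P :: "'a::field mat"
  assumes P: "P \<in> carrier_mat n n" and J: "J \<subseteq> {..<n}" and I: "I \<subseteq> {..<n}"
    and card: "card I < card J"
  shows "\<exists>v. v \<in> carrier_vec n \<and> v \<noteq> 0\<^sub>v n \<and> (\<forall>l<n. l \<notin> J \<longrightarrow> v $ l = 0) \<and>
    (\<forall>i\<in>I. (P *\<^sub>v v) $ i = 0)"
proof -
  have fin: "finite I" "finite J" using I J finite_subset by blast+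
  \<comment> \<open>\<open>g\<close> gives each equation its own row index in \<open>J\<close>;
    since \<open>I\<close> is smaller, some index \<open>k\<close> of \<open>J\<close> stays
    free.\<close>
  obtain g where g: "inj_on g I" "g ` I \<subseteq> J"
    using card_le_inj[OF fin] card by auto
  have "g ` I \<noteq> J" using g card by (metis card_image less_irrefl)
  then obtain k where k: "k \<in> J" "k \<notin> g ` I" using g by auto
  txt \<open>\<open>M v = 0\<close> encodes all the required equations, and position \<open>k\<close> is left for a zero row.\<close>
  define row' where
    "row' l = (if l \<in> g ` I then row P (the_inv_into I g l) else unit_vec n l)" for l
  define M where "M = mat\<^sub>r n n (\<lambda>l. if l = k then 0\<^sub>v n else row' l)"
  have M: "M \<in> carrier_mat n n" by (simp add: M_def)
  have inv: "the_inv_into I g (g i) = i" if "i \<in> I" for i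
    using that g by (simp add: the_inv_into_f_f)
  have row': "row' l \<in> carrier_vec n" for l
    using P by (auto simp: row'_def)
  have "det M = 0"
    unfolding M_def using k J row' by (intro det_row_0) auto
  then obtain v where v: "v \<in> carrier_vec n" "v \<noteq> 0\<^sub>v n" "M *\<^sub>v v = 0\<^sub>v n"
    using det_0_iff_vec_prod_zero_field[OF M] by auto
  have Mv: "row' l \<bullet> v = 0" if "l < n" "l \<noteq> k" for l
    using arg_cong[OF v(3), of "\<lambda>u. u $ l"] that M row'
    by (simp add: M_def)
  have "v $ l = 0" if "l < n" "l \<notin> J" for l
  proof -
    have "l \<noteq> k" "l \<notin> g ` I" using that k g by auto
    then show ?thesis using Mv[of l] that v(1) by (simp add: row'_def)
  qed
  moreover have "(P *\<^sub>v v) $ i = 0" if "i \<in> I" for i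
  proof -
    have "g i \<in> J" using that g by blast
    then have "row' (g i) \<bullet> v = 0" using that J k by (intro Mv) auto
    then show ?thesis using that I P by (auto simp: row'_def inv)
  qed
  ultimately show ?thesis using v(1,2) by blast
qed

text \<open>By symmetry the two halves of the bound on each product have the same total, and
  together they weight each square by its row sum. Asking for the bound \<open>t\<close> only where
  \<open>x i\<close> is nonzero allows rows with larger sums, provided that \<open>x\<close>
  vanishes there.\<close>

lemma symmetric_quadratic_form_le:
  fixes A :: "real mat"
  assumes A: "A \<in> carrier_mat n n" "A\<^sup>T = A"
    and t: "\<And>i. i < n \<Longrightarrow> x i \<noteq> 0 \<Longrightarrow> (\<Sum>j<n. \<bar>A $$ (i, j)\<bar>) \<le> t"
  shows "(\<Sum>i<n. \<Sum>j<n. A $$ (i, j) * x i * x j) \<le> t * (\<Sum>i<n. (x i)\<^sup>2)"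
proof -
  have "A $$ (i, j) * x i * x j \<le> \<bar>A $$ (i, j)\<bar> * (x i)\<^sup>2 / 2 + \<bar>A $$ (i, j)\<bar> * (x j)\<^sup>2 / 2" for i j
  proof -
    \<comment> \<open>The two signs together bound the absolute value, which is needed because
      entries of \<open>A\<close> may be negative.\<close>
    have "x i * x j \<le> ((x i)\<^sup>2 + (x j)\<^sup>2) / 2" "- (x i * x j) \<le> ((x i)\<^sup>2 + (x j)\<^sup>2) / 2"
      using sum_squares_bound[of "x i" "x j"] sum_squares_bound[of "x i" "- x j"] by auto
    then have "\<bar>x i * x j\<bar> \<le> ((x i)\<^sup>2 + (x j)\<^sup>2) / 2" by linarith
    then have "\<bar>A $$ (i, j)\<bar> * \<bar>x i * x j\<bar> \<le> \<bar>A $$ (i, j)\<bar> * (((x i)\<^sup>2 + (x j)\<^sup>2) / 2)"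
      by (intro mult_left_mono) auto
    moreover have "A $$ (i, j) * x i * x j \<le> \<bar>A $$ (i, j)\<bar> * \<bar>x i * x j\<bar>"
      by (metis abs_ge_self abs_mult mult.assoc)
    ultimately show ?thesis by (simp add: field_simps)
  qed
  then have "(\<Sum>i<n. \<Sum>j<n. A $$ (i, j) * x i * x j)
      \<le> (\<Sum>i<n. \<Sum>j<n. \<bar>A $$ (i, j)\<bar> * (x i)\<^sup>2 / 2 + \<bar>A $$ (i, j)\<bar> * (x j)\<^sup>2 / 2)"
    by (intro sum_mono)
  also have "\<dots> = (\<Sum>i<n. \<Sum>j<n. \<bar>A $$ (i, j)\<bar> * (x i)\<^sup>2 / 2)
      + (\<Sum>i<n. \<Sum>j<n. \<bar>A $$ (i, j)\<bar> * (x j)\<^sup>2 / 2)"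
    by (simp add: sum.distrib)
  also have "(\<Sum>i<n. \<Sum>j<n. \<bar>A $$ (i, j)\<bar> * (x j)\<^sup>2 / 2)
      = (\<Sum>j<n. \<Sum>i<n. \<bar>A $$ (i, j)\<bar> * (x j)\<^sup>2 / 2)"
    by (rule sum.swap)
  also have "\<dots> = (\<Sum>i<n. \<Sum>j<n. \<bar>A $$ (i, j)\<bar> * (x i)\<^sup>2 / 2)"
    by (intro sum.cong refl) (simp add: symmetric_mat_swap[OF A])
  also have "(\<Sum>i<n. \<Sum>j<n. \<bar>A $$ (i, j)\<bar> * (x i)\<^sup>2 / 2)
      + (\<Sum>i<n. \<Sum>j<n. \<bar>A $$ (i, j)\<bar> * (x i)\<^sup>2 / 2)
      = (\<Sum>i<n. (\<Sum>j<n. \<bar>A $$ (i, j)\<bar>) * (x i)\<^sup>2)"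
    by (simp add: sum.distrib[symmetric] sum_distrib_right)
  also have "\<dots> \<le> (\<Sum>i<n. t * (x i)\<^sup>2)"
  proof (rule sum_mono)
    fix i assume "i \<in> {..<n}"
    then show "(\<Sum>j<n. \<bar>A $$ (i, j)\<bar>) * (x i)\<^sup>2 \<le> t * (x i)\<^sup>2"
      using t[of i] by (cases "x i = 0") (auto intro: mult_right_mono)
  qed
  finally show ?thesis by (simp add: sum_distrib_left)
qed

lemma quadratic_form_as_sum:
  fixes A :: "'a::comm_semiring_0 mat"
  assumes "A \<in> carrier_mat n n" "x \<in> carrier_vec n"
  shows "x \<bullet> (A *\<^sub>v x) = (\<Sum>i<n. \<Sum>j<n. A $$ (i, j) * x $ i * x $ j)"
  using assms by (simp add: scalar_prod_def atLeast0LessThan sum_distrib_left ac_simps)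

text \<open>Phrasing the comparison by counts keeps it free of any sorting. The strict inequality of
  the counts is exactly what the dimension count above needs.\<close>

lemma diagonal_entry_le_abs_row_sum:
  fixes A :: "real mat"
  assumes A: "A \<in> carrier_mat n n" "A\<^sup>T = A" and P: "P \<in> carrier_mat n n" "P\<^sup>T * P = 1\<^sub>m n"
    and diag: "P\<^sup>T * A * P = mat_diag n f"
    and card: "card {i. i < n \<and> (\<Sum>j<n. \<bar>A $$ (i, j)\<bar>) > t} < card {l. l < n \<and> f l \<ge> s}"
  shows "s \<le> t"
proof -
  obtain v where v: "v \<in> carrier_vec n" "v \<noteq> 0\<^sub>v n"
    and vJ: "\<And>l. l < n \<Longrightarrow> f l < s \<Longrightarrow> v $ l = 0"
    and vI: "\<And>i. i < n \<Longrightarrow> (\<Sum>j<n. \<bar>A $$ (i, j)\<bar>) > t \<Longrightarrow> (P *\<^sub>v v) $ i = 0"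
    using exists_supported_vec_with_mult_vanishing_on[OF P(1) _ _ card] by force
  define x where "x = P *\<^sub>v v"
  have x: "x \<in> carrier_vec n" using P v by (simp add: x_def)
  \<comment> \<open>Moving \<open>P\<close> to the other side of the scalar product rewrites both
    \<open>x \<bullet> x\<close> and the form of \<open>A\<close> in the eigenvector coordinates
    \<open>v\<close>.\<close>
  have swap: "x \<bullet> w = v \<bullet> (P\<^sup>T *\<^sub>v w)" if "w \<in> carrier_vec n" for w
    using transpose_vec_mult_scalar[OF P(1) v(1) that] P v that
    by (metis comm_scalar_prod mult_mat_vec_carrier transpose_carrier_mat x_def)
  define N where "N = (\<Sum>l<n. (v $ l)\<^sup>2)"
  have "x \<bullet> x = v \<bullet> (P\<^sup>T *\<^sub>v (P *\<^sub>v v))" using swap[OF x] by (simp add: x_def)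
  also have "P\<^sup>T *\<^sub>v (P *\<^sub>v v) = (P\<^sup>T * P) *\<^sub>v v"
    using P(1) v(1) by (intro assoc_mult_mat_vec[symmetric]) auto
  finally have xx: "(\<Sum>i<n. (x $ i)\<^sup>2) = N"
    using v x by (simp add: P(2) N_def scalar_prod_def atLeast0LessThan power2_eq_square)
  have "x \<bullet> (A *\<^sub>v x) = v \<bullet> ((P\<^sup>T * A * P) *\<^sub>v v)"
    using swap[of "A *\<^sub>v x"] A x P v by (simp add: x_def assoc_mult_mat_vec[of _ n n _ n])
  also have "\<dots> = (\<Sum>i<n. \<Sum>j<n. mat_diag n f $$ (i, j) * v $ i * v $ j)"
    unfolding diag using v(1) by (intro quadratic_form_as_sum) auto
  also have "\<dots> = (\<Sum>i<n. \<Sum>j<n. if j = i then f i * (v $ i)\<^sup>2 else 0)"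
    by (intro sum.cong refl) (auto simp: mat_diag_def power2_eq_square)
  also have "\<dots> = (\<Sum>l<n. f l * (v $ l)\<^sup>2)" by simp
  \<comment> \<open>Coordinates with \<open>f l < s\<close> contribute nothing because
    \<open>v\<close> vanishes there.\<close>
  also have "\<dots> \<ge> (\<Sum>l<n. s * (v $ l)\<^sup>2)"
  proof (rule sum_mono)
    fix l assume "l \<in> {..<n}"
    then show "s * (v $ l)\<^sup>2 \<le> f l * (v $ l)\<^sup>2"
      using vJ[of l] by (cases "f l < s") (auto intro: mult_right_mono)
  qed
  finally have "s * N \<le> x \<bullet> (A *\<^sub>v x)" by (simp add: N_def sum_distrib_left)
  also have "\<dots> \<le> t * N"
    unfolding quadratic_form_as_sum[OF A(1) x] xx[symmetric]
    using vI by (intro symmetric_quadratic_form_le[OF A]) (force simp: x_def)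
  finally have "s * N \<le> t * N" .
  moreover have "N > 0"
  proof -
    obtain l where "l < n" "v $ l \<noteq> 0"
      using v by (metis carrier_vecD eq_vecI index_zero_vec)
    then show ?thesis unfolding N_def by (intro sum_pos2[of _ l]) auto
  qed
  ultimately show ?thesis by simp
qed

section \<open>Counting in descending lists\<close>

text \<open>Positions 0 to \<open>k\<close> of the descending list give \<open>k + 1\<close> such
  entries; filtering the common multiset carries the count over to the indices of
  \<open>f\<close>.\<close>

lemma card_ge_nth_rev_sorted_list:
  fixes f :: "nat \<Rightarrow> 'a::linorder" and n k :: nat
  defines "ys \<equiv> rev (sorted_list_of_multiset (image_mset f (mset_set {..<n})))"
  assumes "k < n"
  shows "k < card {i. i < n \<and> ys ! k \<le> f i}"
proof -
  have mset: "mset ys = image_mset f (mset_set {..<n})" by (simp add: ys_def)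
  have len: "length ys = n" by (metis mset card_lessThan size_image_mset size_mset size_mset_set)
  have sorted: "sorted (rev ys)" by (simp add: ys_def)
  have "Suc k = card {..k}" by simp
  also have "\<dots> \<le> card {i. i < length ys \<and> ys ! k \<le> ys ! i}"
    using \<open>k < n\<close> len by (intro card_mono) (auto intro: sorted_rev_nth_mono[OF sorted])
  also have "\<dots> = size (filter_mset ((\<le>) (ys ! k)) (mset ys))"
    by (metis length_filter_conv_card mset_filter size_mset)
  also have "\<dots> = card {i. i < n \<and> ys ! k \<le> f i}"
    by (simp add: mset filter_mset_image_mset)
  finally show ?thesis by simp
qed

text \<open>An entry strictly above the one at position \<open>k\<close> must stand at one of the
  \<open>k\<close> earlier positions.\<close>

lemma card_greater_nth_rev_sorted_list:
  fixes f :: "nat \<Rightarrow> 'a::linorder" and n k :: nat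
  defines "ys \<equiv> rev (sorted_list_of_multiset (image_mset f (mset_set {..<n})))"
  assumes "k < n"
  shows "card {i. i < n \<and> ys ! k < f i} \<le> k"
proof -
  have mset: "mset ys = image_mset f (mset_set {..<n})" by (simp add: ys_def)
  have len: "length ys = n" by (metis mset card_lessThan size_image_mset size_mset size_mset_set)
  have sorted: "sorted (rev ys)" by (simp add: ys_def)
  have "card {i. i < n \<and> ys ! k < f i} = size (filter_mset ((<) (ys ! k)) (mset ys))"
    by (simp add: mset filter_mset_image_mset)
  also have "\<dots> = card {i. i < length ys \<and> ys ! k < ys ! i}"
    by (metis length_filter_conv_card mset_filter size_mset)
  also have "\<dots> \<le> card {..<k}"
  proof (intro card_mono subsetI)
    fix i assume "i \<in> {i. i < length ys \<and> ys ! k < ys ! i}"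
    then show "i \<in> {..<k}"
      using sorted_rev_nth_mono[OF sorted, of k i] by (auto simp: not_less[symmetric])
  qed simp
  finally show ?thesis by simp
qed

section \<open>The bound for symmetric matrices and for Dirac matrices\<close>

text \<open>The length claim records that no eigenvalue is lost by taking real roots only, so that
  position \<open>k\<close> really holds an eigenvalue.\<close>

lemma real_symmetric_mat_eigenvalues_le_abs_row_sums:
  fixes A :: "real mat"
  assumes A: "A \<in> carrier_mat n n" "A\<^sup>T = A"
  defines "r \<equiv> \<lambda>i. \<Sum>j<n. \<bar>A $$ (i, j)\<bar>"
  shows "length (eigenvalues_desc A) = n"
    and "k < n \<Longrightarrow> eigenvalues_desc A ! k
      \<le> rev (sorted_list_of_multiset (image_mset r (mset_set {..<n}))) ! k"
proof -
  obtain P f where P: "P \<in> carrier_mat n n" "P\<^sup>T * P = 1\<^sub>m n"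
    and diag: "P\<^sup>T * A * P = mat_diag n f"
    using real_symmetric_mat_diagonalization[OF A] by blast
  have ev: "eigenvalues_desc A = rev (sorted_list_of_multiset (image_mset f (mset_set {..<n})))"
    by (simp add: eigenvalues_desc_def proots_char_poly_diagonalized[OF A(1) P diag])
  have "length (sorted_list_of_multiset M) = size M" for M :: "real multiset"
    by (metis mset_sorted_list_of_multiset size_mset)
  then show "length (eigenvalues_desc A) = n" by (simp add: ev)
  show "eigenvalues_desc A ! k \<le> rev (sorted_list_of_multiset (image_mset r (mset_set {..<n}))) ! k"
    if "k < n"
    \<comment> \<open>With \<open>s\<close> and \<open>t\<close> the entries at position
      \<open>k\<close>, at most \<open>k\<close> rows exceed \<open>t\<close> while more than
      \<open>k\<close> eigenvalues reach \<open>s\<close>.\<close>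
    using diagonal_entry_le_abs_row_sum[OF A P diag]
      card_ge_nth_rev_sorted_list[OF that, of f] card_greater_nth_rev_sorted_list[OF that, of r]
    unfolding ev r_def by (meson le_less_trans)
qed

text \<open>\<open>dirac\<close> is symmetric in its two arguments, and the absolute row sums of its
  matrix are the degrees once positions in \<open>xs\<close> are replaced by the simplices they
  enumerate.\<close>

lemma dirac_eigenvalues_le_degrees:
  assumes "distinct xs" "set xs = U"
  shows "length (eigenvalues_desc (dirac_matrix vs xs)) = card U"
    and "k < card U \<Longrightarrow> eigenvalues_desc (dirac_matrix vs xs) ! k \<le> degrees_desc vs U ! k"
proof -
  let ?A = "dirac_matrix vs xs" and ?n = "length xs"
  have n: "card U = ?n" using assms distinct_card by blast
  have A: "?A \<in> carrier_mat ?n ?n" by (simp add: dirac_matrix_def)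
  have sym: "?A\<^sup>T = ?A" by (intro eq_matI) (auto simp: dirac_matrix_def dirac_def)
  have bij: "bij_betw ((!) xs) {..<?n} U" using assms by (simp add: bij_betw_nth)
  have "(\<Sum>j<?n. \<bar>?A $$ (i, j)\<bar>) = dirac_degree vs U (xs ! i)" if "i < ?n" for i
    using that sum.reindex_bij_betw[OF bij, of "\<lambda>y. \<bar>dirac vs (xs ! i) y\<bar>"]
    by (simp add: dirac_matrix_def dirac_degree_def)
  then have "image_mset (\<lambda>i. \<Sum>j<?n. \<bar>?A $$ (i, j)\<bar>) (mset_set {..<?n})
      = image_mset (dirac_degree vs U) (image_mset ((!) xs) (mset_set {..<?n}))"
    by (auto simp: multiset.map_comp intro!: image_mset_cong)
  also have "image_mset ((!) xs) (mset_set {..<?n}) = mset_set U"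
    using bij by (simp add: bij_betw_def image_mset_mset_set)
  finally have deg: "degrees_desc vs U = rev (sorted_list_of_multiset
      (image_mset (\<lambda>i. \<Sum>j<?n. \<bar>?A $$ (i, j)\<bar>) (mset_set {..<?n})))"
    by (simp add: degrees_desc_def)
  show "length (eigenvalues_desc ?A) = card U"
    using real_symmetric_mat_eigenvalues_le_abs_row_sums(1)[OF A sym] n by simp
  show "eigenvalues_desc ?A ! k \<le> degrees_desc vs U ! k" if "k < card U"
    using real_symmetric_mat_eigenvalues_le_abs_row_sums(2)[OF A sym] that n unfolding deg by simp
qed

theorem theorem3:
  fixes G :: "'a set set" and vs :: "'a set \<Rightarrow> 'a list" and n :: nat
  assumes "simplicial_complex G" and "card G = n" and "vertex_ordering G vs"
  shows
    "(\<forall>xs. distinct xs \<and> set xs = G \<longrightarrow>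
        length (eigenvalues_desc (dirac_matrix vs xs)) = n \<and>
        (\<forall>j\<in>{1..n}. eigenvalues_desc (dirac_matrix vs xs) ! (j - 1) \<le> degrees_desc vs G ! (j - 1)))
     \<and>
     (\<forall>U xs. open_in G U \<and> distinct xs \<and> set xs = U \<longrightarrow>
        length (eigenvalues_desc (dirac_matrix vs xs)) = card U \<and>
        (\<forall>j\<in>{1..card U}. eigenvalues_desc (dirac_matrix vs xs) ! (j - 1) \<le> degrees_desc vs U ! (j - 1)))"
  using assms(2) dirac_eigenvalues_le_degrees by force

end
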